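(* Let $m\ge 2$, let $\beta\in\mathbb{R}^{m-1}$, and let $\xi$ be a design for the Bradley--Terry paired comparison model with $m$ alternatives. If $\xi$ is saturated and locally $D$-optimal for $\beta$, then the graph representation of $\xi$ is a path on the vertex set $[m]=\{1,2,\ldots,m\}$.
   Context: Bradley--Terry model with $m\ge 2$ alternatives. The parameters are $\beta=(\beta_1,\dots,\beta_{m-1})^T\in\mathbb{R}^{m-1}$, with the convention $\beta_m=0$. Let $e_1,\dots,e_{m-1}$ be the standard unit vectors of $\mathbb{R}^{m-1}$. For $1\le i<j\le m$ the regression vector is $f(i,j)=e_i-e_j$ if $j<m$ and $f(i,m)=e_i$. The intensity is $\lambda_{ij}=\lambda_{ij}(\beta)=\dfrac{e^{\beta_i-\beta_j}}{(1+e^{\beta_i-\beta_j})^2}$ (symmetric in $i,j$). A design $\xi$ is an assignment of a real weight $w_{ij}\ge 0$ to each pair $(i,j)$ with $1\le i<j\le m$ such that $\sum_{i<j}w_{ij}=1$; the set of all designs is identified with the simplex $\Delta_{\binom m2}$. The support of $\xi$ is the set of pairs $(i,j)$ with $w_{ij}>0$. The information matrix is $M(\xi,\beta)=\sum_{i<j}w_{ij}\lambda_{ij}f(i,j)f(i,j)^T\in\mathbb{R}^{(m-1)\times(m-1)}$. A design $\xi^*$ is locally $D$-optimal for $\beta$ if $\log\det M(\xi^*,\beta)\ge\log\det M(\xi,\beta)$ for all designs $\xi$ (with $\log 0=-\infty$). A design is saturated if its support has exactly $m-1$ elements (the number of free parameters). The graph representation of a design is the undirected simple graph with vertex set $\{1,\dots,m\}$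 and edge set $\{(i,j): w_{ij}>0\}$. A tree is a connected graph with no cycles; a path is a tree in which every vertex is connected to at most two other vertices. *)

theory Defs
  imports
    "HOL-Library.Extended_Real"
    "Jordan_Normal_Form.Determinant"
    "Graph_Theory.Graph_Theory"
begin

text \<open>
  Alternatives are numbered \<open>1, \<dots>, m\<close>, whereas the coordinates of a \<^typ>\<open>real vec\<close> are
  numbered from \<open>0\<close>; the parameter of alternative \<open>i < m\<close> is thus coordinate \<open>i - 1\<close>.
\<close>

definition pairs :: "nat \<Rightarrow> (nat \<times> nat) set" where
  "pairs m = {(i, j). 1 \<le> i \<and> i < j \<and> j \<le> m}"

definition param :: "nat \<Rightarrow> real vec \<Rightarrow> nat \<Rightarrow> real" where
  "param m \<beta> i = (if i < m then \<beta> $ (i - 1) else 0)"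

definition intensity :: "nat \<Rightarrow> real vec \<Rightarrow> nat \<Rightarrow> nat \<Rightarrow> real" where
  "intensity m \<beta> i j =
     exp (param m \<beta> i - param m \<beta> j) / (1 + exp (param m \<beta> i - param m \<beta> j)) ^ 2"

definition regression_vec :: "nat \<Rightarrow> nat \<Rightarrow> nat \<Rightarrow> real vec" where
  "regression_vec m i j =
     (if j < m then unit_vec (m - 1) (i - 1) - unit_vec (m - 1) (j - 1)
      else unit_vec (m - 1) (i - 1))"

text \<open>
  A design is a weight function on pairs. Its values outside \<^term>\<open>pairs m\<close> are unconstrained,
  and no notion below depends on them.
\<close>

definition design :: "nat \<Rightarrow> (nat \<times> nat \<Rightarrow> real) \<Rightarrow> bool" where
  "design m w \<longleftrightarrow> (\<forall>p \<in> pairs m. 0 \<le> w p) \<and> (\<Sum>p \<in> pairs m. w p) = 1"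

definition support :: "nat \<Rightarrow> (nat \<times> nat \<Rightarrow> real) \<Rightarrow> (nat \<times> nat) set" where
  "support m w = {p \<in> pairs m. w p > 0}"

definition saturated :: "nat \<Rightarrow> (nat \<times> nat \<Rightarrow> real) \<Rightarrow> bool" where
  "saturated m w \<longleftrightarrow> card (support m w) = m - 1"

text \<open>The sum of the matrices \<open>w\<^sub>i\<^sub>j \<lambda>\<^sub>i\<^sub>j f(i,j) f(i,j)\<^sup>T\<close>, taken entrywise.\<close>

definition information_mat :: "nat \<Rightarrow> real vec \<Rightarrow> (nat \<times> nat \<Rightarrow> real) \<Rightarrow> real mat" where
  "information_mat m \<beta> w = mat (m - 1) (m - 1) (\<lambda>(r, c).
     \<Sum>(i, j) \<in> pairs m.
       w (i, j) * intensity m \<beta> i j * (regression_vec m i j $ r * regression_vec m i j $ c))"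

text \<open>
  The logarithm with \<open>log 0 = -\<infinity>\<close>. It is only applied to determinants of positive
  semidefinite matrices, so the value at negative arguments is irrelevant.
\<close>

definition elog :: "real \<Rightarrow> ereal" where
  "elog x = (if x > 0 then ereal (ln x) else -\<infinity>)"

definition locally_D_optimal :: "nat \<Rightarrow> real vec \<Rightarrow> (nat \<times> nat \<Rightarrow> real) \<Rightarrow> bool" where
  "locally_D_optimal m \<beta> w \<longleftrightarrow> design m w \<and>
     (\<forall>w'. design m w' \<longrightarrow>
        elog (det (information_mat m \<beta> w)) \<ge> elog (det (information_mat m \<beta> w')))"

text \<open>
  An undirected simple graph is represented by a \<^locale>\<open>pair_graph\<close>: a finite, loop-free,
  symmetric digraph, where each undirected edge gives the two arcs \<open>(i, j)\<close> and \<open>(j, i)\<close>.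
\<close>

definition design_graph :: "nat \<Rightarrow> (nat \<times> nat \<Rightarrow> real) \<Rightarrow> nat pair_pre_digraph" where
  "design_graph m w = \<lparr> pverts = {1..m}, parcs = support m w \<union> (support m w)\<inverse> \<rparr>"

text \<open>
  The library's predicate \<^const>\<open>tree\<close> is not suitable here: since its cycles are directed and may
  have length \<open>2\<close>, going along an edge and back would count as a cycle. In a \<^locale>\<open>pair_graph\<close>,
  the cycles of the undirected graph are exactly the cycles of length at least \<open>3\<close>.
\<close>

definition undirected_tree :: "'a pair_pre_digraph \<Rightarrow> bool" where
  "undirected_tree G \<longleftrightarrow> pair_graph G \<and> Digraph_Component.connected (with_proj G) \<and>
     \<not> (\<exists>p. pre_digraph.cycle (with_proj G) p \<and> length p \<ge> 3)"

definition path_graph :: "'a pair_pre_digraph \<Rightarrow> bool" where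
  "path_graph G \<longleftrightarrow> undirected_tree G \<and>
     (\<forall>u \<in> pverts G. card {v \<in> pverts G. (u, v) \<in> parcs G} \<le> 2)"

end

theory Submission
  imports Defs
begin

text \<open>
  The information matrix is the Laplacian of the design graph with edge weights \<open>w\<^sub>i\<^sub>j \<lambda>\<^sub>i\<^sub>j\<close>, with row
  and column \<open>m\<close> removed. Some design has a nonsingular information matrix (the star around \<open>m\<close>), so
  the matrix of an optimal design is nonsingular. A potential on the vertices that is constant
  along all edges without being constant would give a kernel vector; hence the design graph is
  connected (\<open>edge_constant_potential\<close>). A saturated design has as many
  edges as coordinates, so the edge vectors are then linearly independent. By duality every edge
  has a potential that changes along this edge only (\<open>edge_separating_potential\<close>), which is
  impossible for an edge on a cycle. The design graph is therefore a tree.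

  It remains to exclude vertices of degree \<open>3\<close> or more. Let \<open>v\<close> be such a vertex. Two of its
  neighbours, \<open>a\<close> and \<open>b\<close>, have parameters on the same side of \<open>\<beta>\<^sub>v\<close>. Since
  \<open>1 / \<lambda>\<^sub>i\<^sub>j = 2 + 2 cosh (\<beta>\<^sub>i - \<beta>\<^sub>j)\<close>, this gives \<open>1 / \<lambda>\<^sub>a\<^sub>b < 1 / \<lambda>\<^sub>a\<^sub>v + 1 / \<lambda>\<^sub>b\<^sub>v\<close>
  (\<open>intensity_detour\<close>). If the pairs \<open>{a, v}\<close>, \<open>{b, v}\<close> and \<open>{a, b}\<close> carry conductances
  \<open>w\<^sub>i\<^sub>j \<lambda>\<^sub>i\<^sub>j\<close> equal to \<open>p\<close>, \<open>q\<close> and \<open>t\<close> while all other conductances stay fixed, the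
  determinant is a constant multiple of \<open>p q + p t + q t\<close> (\<open>det_triangle_gram\<close>), the weighted number
  of spanning trees of the triangle. Averaging the weights of \<open>{a, v}\<close> and \<open>{b, v}\<close> and moving a
  little of both to \<open>{a, b}\<close> increases this quantity (\<open>better_split\<close>), against optimality.
\<close>

section \<open>Information matrices as weighted graph Laplacians\<close>

text \<open>
  The incidence vector of the edge \<open>i j\<close>, with the entry of vertex \<open>m\<close> dropped. For \<open>(i, j) \<in> pairs m\<close>
  it is the regression vector, but it makes sense for either orientation, and incidence vectors
  add up along walks without a case distinction for \<open>m\<close>.
\<close>

definition edge_diff :: "nat \<Rightarrow> nat \<Rightarrow> nat \<Rightarrow> real" where
  "edge_diff i j r = of_bool (i = Suc r) - of_bool (j = Suc r)"

definition edge_info :: "nat \<Rightarrow> real vec \<Rightarrow> nat \<times> nat \<Rightarrow> nat \<Rightarrow> nat \<Rightarrow> real" where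
  "edge_info m \<beta> p r c = intensity m \<beta> (fst p) (snd p) *
     (edge_diff (fst p) (snd p) r * edge_diff (fst p) (snd p) c)"

definition edge :: "nat \<Rightarrow> nat \<Rightarrow> nat \<times> nat" where
  "edge i j = (min i j, max i j)"

lemma edge_eq_iff: "edge i j = edge k l \<longleftrightarrow> i = k \<and> j = l \<or> i = l \<and> j = k"
  by (auto simp: edge_def min_def max_def)

lemma edge_in_pairs: "edge i j \<in> pairs m \<longleftrightarrow> i \<noteq> j \<and> {i, j} \<subseteq> {1..m}"
  by (auto simp: edge_def pairs_def)

lemma finite_pairs: "finite (pairs m)"
  by (rule finite_subset[of _ "{1..m} \<times> {1..m}"]) (auto simp: pairs_def)

lemma finite_support: "finite (support m w)"
  using finite_pairs[of m] by (simp add: support_def)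

lemma regression_vec_index:
  assumes "(i, j) \<in> pairs m" "r < m - 1"
  shows "regression_vec m i j $ r = edge_diff i j r"
  using assms by (auto simp: regression_vec_def edge_diff_def pairs_def)

lemma information_mat_edge_info:
  "information_mat m \<beta> w =
     mat (m - 1) (m - 1) (\<lambda>(r, c). \<Sum>p \<in> pairs m. w p * edge_info m \<beta> p r c)"
  unfolding information_mat_def
  by (rule eq_matI)
    (auto simp: edge_info_def regression_vec_index algebra_simps intro!: sum.cong)

lemma sum_pairs_support:
  assumes "design m w"
  shows "(\<Sum>p \<in> pairs m. w p * h p) = (\<Sum>p \<in> support m w. w p * h p)"
  using assms
  by (intro sum.mono_neutral_right finite_pairs)
     (auto simp: support_def design_def dest!: bspec)

lemma information_mat_support:
  assumes "design m w"
  shows "information_mat m \<beta> w =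
     mat (m - 1) (m - 1) (\<lambda>(r, c). \<Sum>p \<in> support m w. w p * edge_info m \<beta> p r c)"
  by (simp add: information_mat_edge_info sum_pairs_support[OF assms])

lemma intensity_cosh:
  "intensity m \<beta> i j = 1 / (2 + 2 * cosh (param m \<beta> i - param m \<beta> j))"
proof -
  define x where "x = exp (param m \<beta> i - param m \<beta> j)"
  have x: "x > 0" by (simp add: x_def)
  have "exp (- (param m \<beta> i - param m \<beta> j)) = 1 / x"
    unfolding x_def exp_minus by (simp add: inverse_eq_divide)
  then have "2 + 2 * cosh (param m \<beta> i - param m \<beta> j) = 2 + x + 1 / x"
    unfolding cosh_def by (simp add: x_def)
  also have "\<dots> = (1 + x)\<^sup>2 / x"
    using x by (simp add: field_simps power2_eq_square)
  finally show ?thesis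
    by (simp add: intensity_def x_def)
qed

lemma intensity_pos: "intensity m \<beta> i j > 0"
  unfolding intensity_cosh by (simp add: add_pos_pos)

lemma intensity_commute: "intensity m \<beta> i j = intensity m \<beta> j i"
  using cosh_minus[of "param m \<beta> i - param m \<beta> j"] by (simp add: intensity_cosh)

lemma edge_info_edge:
  "edge_info m \<beta> (edge i j) r c = intensity m \<beta> i j * (edge_diff i j r * edge_diff i j c)"
  by (cases "i \<le> j")
     (auto simp: edge_info_def edge_def edge_diff_def intensity_commute[of m \<beta> j i] min_def max_def)

text \<open>
  The reciprocal intensity of \<open>{a, b}\<close> is less than the sum of those of \<open>{a, v}\<close> and \<open>{b, v}\<close>, stated
  without division. If \<open>a\<close> and \<open>b\<close> lie on the same side of \<open>v\<close>, their difference is at most the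
  larger distance from \<open>v\<close>, and the constant \<open>2\<close> of the second summand makes the inequality strict
  even when parameters coincide.
\<close>

lemma intensity_detour:
  assumes "0 \<le> (param m \<beta> a - param m \<beta> v) * (param m \<beta> b - param m \<beta> v)"
  shows "intensity m \<beta> a v * intensity m \<beta> b v
           < intensity m \<beta> a b * (intensity m \<beta> a v + intensity m \<beta> b v)"
proof -
  define x where "x = param m \<beta> a - param m \<beta> v"
  define y where "y = param m \<beta> b - param m \<beta> v"
  have "\<bar>x - y\<bar> \<le> \<bar>x\<bar> \<or> \<bar>x - y\<bar> \<le> \<bar>y\<bar>"
    using assms by (auto simp: x_def[symmetric] y_def[symmetric] zero_le_mult_iff)
  then have "cosh \<bar>x - y\<bar> \<le> cosh \<bar>x\<bar> \<or> cosh \<bar>x - y\<bar> \<le> cosh \<bar>y\<bar>"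
    by (subst (1 2) cosh_real_nonneg_le_iff) auto
  moreover have "1 \<le> cosh x" "1 \<le> cosh y"
    by (simp_all add: cosh_real_ge_1)
  ultimately have *: "cosh (x - y) < 1 + cosh x + cosh y"
    by auto
  define A B C where "A = 2 + 2 * cosh x" and "B = 2 + 2 * cosh y" and "C = 2 + 2 * cosh (x - y)"
  have pos: "A > 0" "B > 0" "C > 0"
    by (simp_all add: A_def B_def C_def add_pos_pos)
  have "C < A + B"
    using * by (simp add: A_def B_def C_def)
  then have "1 / A * (1 / B) < 1 / C * (1 / A + 1 / B)"
    using pos by (simp add: field_simps)
  then show ?thesis
    by (simp add: intensity_cosh A_def B_def C_def x_def y_def)
qed

section \<open>A design with nonsingular information matrix\<close>

text \<open>
  Spreading the weight evenly over the pairs \<open>(i, m)\<close> gives a diagonal information matrix, because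
  the vectors of these pairs are the unit vectors.
\<close>

lemma star_design_det_pos:
  assumes "m \<ge> 2"
  shows "\<exists>w. design m w \<and> det (information_mat m \<beta> w) > 0"
proof (intro exI conjI)
  define n where "n = m - 1"
  have n: "n > 0" "m = Suc n" using assms by (auto simp: n_def)
  define w :: "nat \<times> nat \<Rightarrow> real" where "w = (\<lambda>p. if snd p = m then 1 / n else 0)"
  have "(\<Sum>p \<in> pairs m. w p) = (\<Sum>p \<in> (\<lambda>i. (i, m)) ` {1..n}. 1 / n)"
    using finite_pairs[of m]
    by (intro sum.mono_neutral_cong_right) (auto simp: w_def n pairs_def)
  also have "\<dots> = 1"
    using n by (simp add: card_image inj_on_def)
  finally show "design m w"
    by (auto simp: design_def w_def)
  have entry: "w p * edge_info m \<beta> p r c =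
      (if p = (Suc r, m) then (if r = c then intensity m \<beta> (Suc r) m / n else 0) else 0)"
    if "p \<in> pairs m" "r < n" "c < n" for p r c
    using that by (auto simp: pairs_def w_def edge_info_def edge_diff_def n)
  have "information_mat m \<beta> w =
      mat n n (\<lambda>(r, c). if r = c then intensity m \<beta> (Suc r) m / n else 0)"
    unfolding information_mat_edge_info
  proof (rule eq_matI, goal_cases)
    case (1 r c)
    then have rc: "r < n" "c < n" by auto
    then have mem: "(Suc r, m) \<in> pairs m" by (auto simp: pairs_def n)
    have "(\<Sum>p \<in> pairs m. w p * edge_info m \<beta> p r c) =
          (\<Sum>p \<in> pairs m. if p = (Suc r, m)
             then (if r = c then intensity m \<beta> (Suc r) m / n else 0) else 0)"
      using rc by (intro sum.cong refl entry)
    then show ?case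
      using rc mem by (simp add: sum.delta finite_pairs n)
  qed (auto simp: n)
  moreover have "det \<dots> = prod_list (diag_mat \<dots>)"
    by (rule det_upper_triangular) auto
  moreover have "\<dots> > 0"
    using n by (auto simp: diag_mat_def prod.list_conv_set_nth intensity_pos intro!: prod_pos)
  ultimately show "det (information_mat m \<beta> w) > 0"
    by simp
qed

lemma locally_D_optimal_det_pos:
  assumes "m \<ge> 2" "locally_D_optimal m \<beta> w"
  shows "det (information_mat m \<beta> w) > 0"
proof -
  obtain w' where w': "design m w'" "det (information_mat m \<beta> w') > 0"
    using star_design_det_pos[OF assms(1)] by blast
  then have "elog (det (information_mat m \<beta> w)) \<ge> elog (det (information_mat m \<beta> w'))"
    using assms(2) by (auto simp: locally_D_optimal_def)
  then show ?thesis
    using w'(2) by (auto simp: elog_def split: if_splits)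
qed

lemma locally_D_optimal_det_le:
  assumes "m \<ge> 2" "locally_D_optimal m \<beta> w" "design m w'"
  shows "det (information_mat m \<beta> w') \<le> det (information_mat m \<beta> w)"
proof -
  have pos: "det (information_mat m \<beta> w) > 0"
    using assms(1,2) by (rule locally_D_optimal_det_pos)
  have "elog (det (information_mat m \<beta> w)) \<ge> elog (det (information_mat m \<beta> w'))"
    using assms by (auto simp: locally_D_optimal_def)
  then show ?thesis
    using pos by (cases "det (information_mat m \<beta> w') > 0") (auto simp: elog_def)
qed

section \<open>Potentials on the vertices\<close>

text \<open>
  Vectors in \<open>\<real>\<^bsup>m-1\<^esup>\<close> are identified with potentials \<open>x\<close> on \<open>{1..m}\<close> that are grounded by \<open>x m = 0\<close>.
  Pairing with an edge vector then gives the potential difference along the edge.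
\<close>

lemma sum_edge_diff:
  assumes "(i, j) \<in> pairs m" "x m = 0"
  shows "(\<Sum>r < m - 1. edge_diff i j r * x (Suc r)) = x i - x j"
proof -
  have *: "(\<Sum>r < m - 1. of_bool (k = Suc r) * x (Suc r)) = x k" if "1 \<le> k" "k \<le> m" for k
  proof (cases "k = m")
    case True
    then show ?thesis using assms(2) by (auto intro!: sum.neutral)
  next
    case False
    have "(\<Sum>r < m - 1. of_bool (k = Suc r) * x (Suc r)) =
          (\<Sum>r < m - 1. if r = k - 1 then x k else 0)"
      using that by (intro sum.cong) auto
    then show ?thesis using False that by (simp add: sum.delta)
  qed
  have "1 \<le> i" "i \<le> m" "1 \<le> j" "j \<le> m" using assms(1) by (auto simp: pairs_def)
  then show ?thesis
    by (simp only: edge_diff_def left_diff_distrib sum_subtractf *)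
qed

text \<open>
  A potential without differences along the edges is, after subtracting its value at \<open>m\<close>, a kernel
  vector of the information matrix. Applied to the indicator of the set of vertices reachable from
  a given one, this yields connectedness.
\<close>

lemma edge_constant_potential:
  fixes x :: "nat \<Rightarrow> real"
  assumes "design m w" "det (information_mat m \<beta> w) \<noteq> 0"
    and const: "\<And>i j. (i, j) \<in> support m w \<Longrightarrow> x i = x j"
    and k: "k \<in> {1..m}"
  shows "x k = x m"
proof (rule ccontr)
  assume neq: "x k \<noteq> x m"
  let ?M = "information_mat m \<beta> w"
  define y where "y i = x i - x m" for i
  define z where "z = vec (m - 1) (\<lambda>r. y (Suc r))"
  have M: "?M \<in> carrier_mat (m - 1) (m - 1)" by (simp add: information_mat_def)
  have z: "z \<in> carrier_vec (m - 1)" by (simp add: z_def)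
  have "k < m" using k neq by (cases "k = m") auto
  then have "z $ (k - 1) \<noteq> 0" "k - 1 < m - 1"
    using k neq by (auto simp: z_def y_def)
  then have "z \<noteq> 0\<^sub>v (m - 1)" by auto
  moreover have "?M *\<^sub>v z = 0\<^sub>v (m - 1)"
  proof (rule eq_vecI)
    fix r assume "r < dim_vec (0\<^sub>v (m - 1) :: real vec)"
    then have r: "r < m - 1" by simp
    have zero: "(\<Sum>c < m - 1. edge_info m \<beta> p r c * y (Suc c)) = 0" if p: "p \<in> support m w" for p
    proof -
      obtain i j where ij: "p = (i, j)" by force
      have "(\<Sum>c < m - 1. edge_diff i j c * y (Suc c)) = y i - y j"
        using p ij by (intro sum_edge_diff) (auto simp: support_def y_def)
      also have "\<dots> = 0" using const p ij by (auto simp: y_def)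
      finally show ?thesis
        by (simp add: edge_info_def ij mult.assoc flip: sum_distrib_left)
    qed
    have "(?M *\<^sub>v z) $ r =
        (\<Sum>c < m - 1. (\<Sum>p \<in> support m w. w p * edge_info m \<beta> p r c) * y (Suc c))"
      using r unfolding information_mat_support[OF assms(1)]
      by (simp add: scalar_prod_def z_def lessThan_atLeast0)
    also have "\<dots> = (\<Sum>p \<in> support m w. w p * (\<Sum>c < m - 1. edge_info m \<beta> p r c * y (Suc c)))"
      by (simp add: sum_distrib_left sum_distrib_right mult.assoc, rule sum.swap)
    also have "\<dots> = 0" using zero by simp
    finally show "(?M *\<^sub>v z) $ r = 0\<^sub>v (m - 1) $ r" using r by simp
  qed (use M in auto)
  ultimately have "det ?M = 0"
    using z unfolding det_0_iff_vec_prod_zero_field[OF M] by blast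
  with assms(2) show False by simp
qed

text \<open>
  For a saturated design the edge vectors are the rows of a square matrix \<open>F\<close>, and the information
  matrix is \<open>F\<^sup>T\<close> times the matrix of the rescaled rows. If it is nonsingular, then so is \<open>F\<close>, and
  any prescribed potential differences along the edges can be realised.
\<close>

lemma edge_separating_potential:
  assumes "design m w" "saturated m w" "det (information_mat m \<beta> w) \<noteq> 0"
    and e: "(a, b) \<in> support m w"
  shows "\<exists>x :: nat \<Rightarrow> real. x a \<noteq> x b \<and> (\<forall>(i, j) \<in> support m w - {(a, b)}. x i = x j)"
proof -
  define n where "n = m - 1"
  have "card (support m w) = card {..<n}"
    using assms(2) by (simp add: saturated_def n_def)
  then obtain en where en: "bij_betw en {..<n} (support m w)"
    using finite_same_card_bij[of "{..<n}" "support m w"] finite_support by auto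
  obtain k where k: "k < n" "en k = (a, b)"
    using e bij_betw_imp_surj_on[OF en] by (metis imageE lessThan_iff)
  define F where "F = mat n n (\<lambda>(k, r). edge_diff (fst (en k)) (snd (en k)) r)"
  define G where "G = mat n n (\<lambda>(k, c). w (en k) *
    (intensity m \<beta> (fst (en k)) (snd (en k)) * edge_diff (fst (en k)) (snd (en k)) c))"
  have F: "F \<in> carrier_mat n n" and G: "G \<in> carrier_mat n n" by (simp_all add: F_def G_def)
  have "information_mat m \<beta> w = transpose_mat F * G"
    unfolding information_mat_support[OF assms(1)] sum.reindex_bij_betw[OF en, symmetric]
    by (rule eq_matI)
       (auto simp: F_def G_def n_def scalar_prod_def edge_info_def lessThan_atLeast0
             intro!: sum.cong)
  then have "det F \<noteq> 0"
    using assms(3) det_mult[of "transpose_mat F" n G] F G by (auto simp: det_transpose)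
  \<comment> \<open>The required potential is a column of the adjugate of \<open>F\<close>, extended by \<open>0\<close> at \<open>m\<close>.\<close>
  define x where "x i = (if i = m then 0 else adj_mat F $$ (i - 1, k))" for i
  have diff: "x i - x j = (if (i, j) = (a, b) then det F else 0)" if ij: "(i, j) \<in> support m w" for i j
  proof -
    obtain l where l: "l < n" "en l = (i, j)"
      using ij bij_betw_imp_surj_on[OF en] by (metis imageE lessThan_iff)
    have "x i - x j = (\<Sum>r < n. edge_diff i j r * x (Suc r))"
      unfolding n_def using ij by (intro sum_edge_diff[symmetric]) (auto simp: support_def x_def)
    also have "\<dots> = (F * adj_mat F) $$ (l, k)"
      using l k adj_mat(1)[OF F]
      by (auto simp: scalar_prod_def F_def lessThan_atLeast0 x_def n_def intro!: sum.cong)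
    also have "\<dots> = (if l = k then det F else 0)"
      using l k by (simp add: adj_mat(2)[OF F])
    also have "l = k \<longleftrightarrow> (i, j) = (a, b)"
      using l k inj_onD[OF bij_betw_imp_inj_on[OF en], of l k] by auto
    finally show ?thesis .
  qed
  show ?thesis
  proof (intro exI conjI ballI)
    show "x a \<noteq> x b" using diff[OF e] \<open>det F \<noteq> 0\<close> by auto
    fix p assume p: "p \<in> support m w - {(a, b)}"
    obtain i j where "p = (i, j)" by force
    with p show "case p of (i, j) \<Rightarrow> x i = x j" using diff[of i j] by auto
  qed
qed

section \<open>Rerouting weight through a triangle\<close>

lemma det_2x2:
  fixes A :: "'a :: comm_ring_1 mat"
  assumes A: "A \<in> carrier_mat 2 2"
  shows "det A = A $$ (0, 0) * A $$ (1, 1) - A $$ (0, 1) * A $$ (1, 0)"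
proof -
  have "cofactor A i 0 = (if i = 0 then A $$ (1, 1) else - (A $$ (0, 1)))" if "i < 2" for i
    using that A by (auto simp: cofactor_def mat_delete_def det_single less_2_cases_iff)
  then show ?thesis
    using laplace_expansion_column[OF A, of 0] by (simp add: numeral_2_eq_2 algebra_simps)
qed

text \<open>
  The \<open>2 \<times> 2\<close> block is the Laplacian of a triangle with conductances \<open>p\<close>, \<open>q\<close>, \<open>t\<close>, grounded at the
  vertex where \<open>p\<close> and \<open>q\<close> meet.
\<close>

lemma det_block_diagonal:
  fixes p q t :: real and d :: "nat \<Rightarrow> real"
  shows "det (four_block_mat (mat 2 2 (\<lambda>(i, j). if i = j then (if i = 0 then p + t else q + t) else - t))
      (0\<^sub>m 2 n) (0\<^sub>m n 2) (mat n n (\<lambda>(i, j). if i = j then d i else 0)))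
    = (p * q + p * t + q * t) * (\<Prod>i < n. d i)"
proof -
  have "det (mat n n (\<lambda>(i, j). if i = j then d i else 0)) =
        prod_list (diag_mat (mat n n (\<lambda>(i, j). if i = j then d i else (0 :: real))))"
    by (rule det_upper_triangular) auto
  also have "\<dots> = (\<Prod>i < n. d i)"
    by (simp add: diag_mat_def prod.list_conv_set_nth lessThan_atLeast0)
  finally show ?thesis
    by (subst det_four_block_mat_lower_left_zero)
       (auto simp: det_2x2 algebra_simps)
qed

text \<open>
  The vectors \<open>x\<close>, \<open>y\<close> and \<open>x - y\<close> of the three triangle edges span at most two dimensions. Therefore the
  matrix is a congruence \<open>F\<^sup>T C F\<close> in which the square matrix \<open>F\<close> with rows \<open>x\<close>, \<open>y\<close>, \<open>v 0\<close>, \<open>v 1\<close>, \<open>\<dots>\<close>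
  is independent of the conductances, and \<open>C\<close> is the block matrix of the preceding lemma. The
  constant \<open>K\<close> is \<open>(det F)\<^sup>2\<close> times the product of the other conductances.
\<close>

lemma det_triangle_gram:
  fixes x y :: "nat \<Rightarrow> real" and v :: "nat \<Rightarrow> nat \<Rightarrow> real" and d :: "nat \<Rightarrow> real"
  shows "\<exists>K. \<forall>p q t. det (mat (n + 2) (n + 2) (\<lambda>(r, c).
      p * (x r * x c) + q * (y r * y c) + t * ((x r - y r) * (x c - y c))
      + (\<Sum>k < n. d k * (v k r * v k c)))) = (p * q + p * t + q * t) * K"
proof (intro exI allI)
  fix p q t :: real
  define f where "f k = (if k = 0 then x else if k = 1 then y else v (k - 2))" for k :: nat
  define F where "F = mat (2 + n) (2 + n) (\<lambda>(k, r). f k r)"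
  define B where "B = mat 2 2 (\<lambda>(i, j). if i = j then (if i = 0 then p + t else q + t) else - t :: real)"
  define D where "D = mat n n (\<lambda>(i, j). if i = j then d i else 0)"
  define C where "C = four_block_mat B (0\<^sub>m 2 n) (0\<^sub>m n 2) D"
  have F: "F \<in> carrier_mat (2 + n) (2 + n)" by (simp add: F_def)
  have C: "C \<in> carrier_mat (2 + n) (2 + n)"
    unfolding C_def by (rule four_block_carrier_mat) (simp_all add: B_def D_def)
  have split: "(\<Sum>l < Suc (Suc n). g l) = g 0 + g 1 + (\<Sum>l < n. g (Suc (Suc l)))"
    for g :: "nat \<Rightarrow> real"
    by (simp add: sum.lessThan_Suc_shift del: sum.lessThan_Suc)
  define G where "G = C * F"
  have G: "G \<in> carrier_mat (2 + n) (2 + n)" using C F by (simp add: G_def)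
  have CF: "G $$ (l, c) =
      (if l = 0 then (p + t) * x c - t * y c else if l = 1 then (q + t) * y c - t * x c
       else d (l - 2) * v (l - 2) c)" if l: "l < 2 + n" and c: "c < 2 + n" for l c
  proof -
    have "G $$ (l, c) = (\<Sum>i < Suc (Suc n). C $$ (l, i) * F $$ (i, c))"
      using l c C F by (simp add: G_def scalar_prod_def lessThan_atLeast0 del: sum.lessThan_Suc)
    also have "\<dots> = C $$ (l, 0) * x c + C $$ (l, 1) * y c + (\<Sum>i < n. C $$ (l, i + 2) * v i c)"
      unfolding split using c by (simp add: F_def f_def)
    also have "(\<Sum>i < n. C $$ (l, i + 2) * v i c) = (if l < 2 then 0 else d (l - 2) * v (l - 2) c)"
    proof (cases "l < 2")
      case True
      then show ?thesis by (auto simp: C_def B_def D_def intro!: sum.neutral)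
    next
      case False
      have "(\<Sum>i < n. C $$ (l, i + 2) * v i c) =
            (\<Sum>i < n. if i = l - 2 then d (l - 2) * v (l - 2) c else 0)"
        using False l by (intro sum.cong) (auto simp: C_def B_def D_def)
      then show ?thesis using False l by (simp add: sum.delta)
    qed
    finally show ?thesis
      using l by (auto simp: C_def B_def D_def)
  qed
  have "mat (n + 2) (n + 2) (\<lambda>(r, c).
      p * (x r * x c) + q * (y r * y c) + t * ((x r - y r) * (x c - y c))
      + (\<Sum>k < n. d k * (v k r * v k c))) = transpose_mat F * G" (is "?L = _")
  proof (rule eq_matI)
    fix r c assume "r < dim_row (transpose_mat F * G)" "c < dim_col (transpose_mat F * G)"
    then have rc: "r < 2 + n" "c < 2 + n" using F G by auto
    have "(transpose_mat F * G) $$ (r, c) =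
        (\<Sum>l < Suc (Suc n). F $$ (l, r) * G $$ (l, c))"
      using rc G F by (simp add: scalar_prod_def lessThan_atLeast0 del: sum.lessThan_Suc)
    also have "\<dots> = x r * ((p + t) * x c - t * y c) + y r * ((q + t) * y c - t * x c)
        + (\<Sum>k < n. v k r * (d k * v k c))"
      unfolding split using rc by (simp add: CF F_def f_def)
    finally show "?L $$ (r, c) = (transpose_mat F * G) $$ (r, c)"
      using rc by (simp add: algebra_simps)
  qed (use F G in auto)
  then have "det ?L = det F * (det C * det F)"
    using F G det_mult[of "transpose_mat F" "2 + n" G] det_mult[OF C F]
    by (simp add: det_transpose[OF F] G_def)
  also have "det C = (p * q + p * t + q * t) * (\<Prod>i < n. d i)"
    unfolding C_def B_def D_def by (rule det_block_diagonal)
  finally show "det ?L = (p * q + p * t + q * t) *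
      ((\<Prod>i < n. d i) * (det (mat (2 + n) (2 + n) (\<lambda>(k, r).
        (if k = 0 then x else if k = 1 then y else v (k - 2)) r)))\<^sup>2)"
    by (simp add: power2_eq_square F_def f_def)
qed

text \<open>
  Here \<open>A\<close>, \<open>B\<close>, \<open>C\<close> are the intensities of \<open>{a, v}\<close>, \<open>{b, v}\<close>, \<open>{a, b}\<close>, and \<open>p\<close>, \<open>q\<close> the weights of the
  first two pairs. Giving both pairs the mean weight \<open>c\<close> does no harm, since \<open>p q \<le> c\<^sup>2\<close>. Moving
  \<open>\<epsilon>\<close> from each of them to \<open>{a, b}\<close> then changes the value at rate \<open>2 c (C (A + B) - A B) > 0\<close>.
\<close>

lemma better_split:
  fixes A B C p q :: real
  assumes "A > 0" "B > 0" "C > 0" "A * B < C * (A + B)" "p > 0" "q > 0"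
  shows "\<exists>s t. s > 0 \<and> t > 0 \<and> 2 * s + t = p + q \<and>
    (p * A) * (q * B) < (s * A) * (s * B) + (s * A) * (t * C) + (s * B) * (t * C)"
proof -
  define c where "c = (p + q) / 2"
  define P where "P = A * B"
  define Q where "Q = C * (A + B)"
  have c: "c > 0" and PQ: "0 < P" "P < Q" using assms by (simp_all add: c_def P_def Q_def)
  \<comment> \<open>The maximiser of the gain, a quadratic polynomial in \<open>\<epsilon>\<close>.\<close>
  define \<epsilon> where "\<epsilon> = c * (Q - P) / (2 * Q - P)"
  have \<epsilon>: "0 < \<epsilon>" "\<epsilon> < c" using c PQ by (simp_all add: \<epsilon>_def field_simps)
  have "\<epsilon> * (2 * Q - P) = c * (Q - P)" using PQ by (simp add: \<epsilon>_def)
  moreover have "(c - \<epsilon>)\<^sup>2 * P + (c - \<epsilon>) * (2 * \<epsilon>) * Q =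
      c\<^sup>2 * P + \<epsilon> * (2 * (c * (Q - P)) - \<epsilon> * (2 * Q - P))"
    by (simp add: power2_eq_square algebra_simps)
  ultimately have "(c - \<epsilon>)\<^sup>2 * P + (c - \<epsilon>) * (2 * \<epsilon>) * Q = c\<^sup>2 * P + \<epsilon> * (c * (Q - P))"
    by simp
  moreover have "p * q \<le> c\<^sup>2"
    using zero_le_power2[of "p - q"] by (simp add: c_def power2_eq_square field_simps)
  then have "p * q * P \<le> c\<^sup>2 * P" using PQ by simp
  moreover have "0 < \<epsilon> * (c * (Q - P))" using \<epsilon> c PQ by simp
  ultimately have "p * q * P < (c - \<epsilon>)\<^sup>2 * P + (c - \<epsilon>) * (2 * \<epsilon>) * Q" by linarith
  then have "(p * A) * (q * B) < ((c - \<epsilon>) * A) * ((c - \<epsilon>) * B) + ((c - \<epsilon>) * A) * (2 * \<epsilon> * C)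
      + ((c - \<epsilon>) * B) * (2 * \<epsilon> * C)"
    by (simp add: P_def Q_def power2_eq_square algebra_simps)
  then show ?thesis
    using \<epsilon> by (intro exI[of _ "c - \<epsilon>"] exI[of _ "2 * \<epsilon>"]) (auto simp: c_def)
qed

lemma sum_three_updates:
  fixes g h :: "'a \<Rightarrow> real"
  assumes "finite S" "a \<in> S" "b \<in> S" "c \<in> S" "a \<noteq> b" "a \<noteq> c" "b \<noteq> c"
  shows "(\<Sum>p \<in> S. (g(a := s, b := u, c := g c + t)) p * h p) =
    (\<Sum>p \<in> S. g p * h p) + (s - g a) * h a + (u - g b) * h b + t * h c"
proof -
  have "(\<Sum>p \<in> S. (g(a := s, b := u, c := g c + t)) p * h p) =
      (\<Sum>p \<in> S. g p * h p + (if p = a then (s - g a) * h a else 0)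
        + (if p = b then (u - g b) * h b else 0) + (if p = c then t * h c else 0))"
    using assms by (intro sum.cong) (auto simp: algebra_simps)
  then show ?thesis
    using assms by (simp add: sum.distrib sum.delta)
qed

text \<open>
  The pair \<open>{a, b}\<close> may already carry weight; the new weight is added to it, and the old one is
  accounted for among the conductances that stay fixed.
\<close>

lemma rerouting_improves:
  assumes w: "design m w" "saturated m w" and det: "det (information_mat m \<beta> w) > 0"
    and supp: "edge a v \<in> support m w" "edge b v \<in> support m w" and ab: "a \<noteq> b"
    and detour: "intensity m \<beta> a v * intensity m \<beta> b v
           < intensity m \<beta> a b * (intensity m \<beta> a v + intensity m \<beta> b v)"
  shows "\<exists>w'. design m w' \<and> det (information_mat m \<beta> w') > det (information_mat m \<beta> w)"
proof -
  let ?e1 = "edge a v" and ?e2 = "edge b v" and ?e3 = "edge a b"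
  let ?L1 = "intensity m \<beta> a v" and ?L2 = "intensity m \<beta> b v" and ?L3 = "intensity m \<beta> a b"
  let ?S = "support m w"
  define R where "R = ?S - {?e1, ?e2}"
  have pairs: "?e1 \<in> pairs m" "?e2 \<in> pairs m" and pos: "w ?e1 > 0" "w ?e2 > 0"
    using supp by (auto simp: support_def)
  have av: "a \<noteq> v" "b \<noteq> v" using pairs by (auto simp: edge_in_pairs)
  have e3: "?e3 \<in> pairs m"
    using pairs ab by (auto simp: edge_in_pairs)
  have neq: "?e1 \<noteq> ?e2" "?e1 \<noteq> ?e3" "?e2 \<noteq> ?e3"
    using ab av by (auto simp: edge_eq_iff)
  have card2: "card {?e1, ?e2} = 2" using neq by simp
  have "card {?e1, ?e2} \<le> card ?S"
    using supp by (intro card_mono finite_support) auto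
  then have ge: "m - 1 \<ge> 2" using w(2) card2 by (simp add: saturated_def)
  define n where "n = m - 3"
  have n: "m - 1 = n + 2" using ge by (simp add: n_def)
  have "card R = n"
    using supp card2 w(2) n unfolding R_def
    by (subst card_Diff_subset) (auto simp: saturated_def)
  then obtain en where en: "bij_betw en {..<n} R"
    using finite_same_card_bij[of "{..<n}" R] finite_support by (auto simp: R_def)
  define d where "d k = w (en k) * intensity m \<beta> (fst (en k)) (snd (en k))" for k
  define T where "T r c =
      (\<Sum>k < n. d k * (edge_diff (fst (en k)) (snd (en k)) r * edge_diff (fst (en k)) (snd (en k)) c))"
    for r c
  define M where "M p q t = mat (n + 2) (n + 2) (\<lambda>(r, c).
      p * (edge_diff a v r * edge_diff a v c) + q * (edge_diff b v r * edge_diff b v c)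
      + t * ((edge_diff a v r - edge_diff b v r) * (edge_diff a v c - edge_diff b v c))
      + T r c)"
    for p q t
  obtain K where K: "\<And>p q t. det (M p q t) = (p * q + p * t + q * t) * K"
    using det_triangle_gram[of n "edge_diff a v" "edge_diff b v" d
        "\<lambda>k. edge_diff (fst (en k)) (snd (en k))"]
    unfolding M_def T_def by blast
  have diff: "edge_diff a v r - edge_diff b v r = edge_diff a b r" for r
    by (simp add: edge_diff_def)
  have base: "(\<Sum>p \<in> pairs m. w p * edge_info m \<beta> p r c) =
      w ?e1 * edge_info m \<beta> ?e1 r c + w ?e2 * edge_info m \<beta> ?e2 r c
      + T r c"
    for r c
  proof -
    have "(\<Sum>p \<in> pairs m. w p * edge_info m \<beta> p r c) = (\<Sum>p \<in> ?S. w p * edge_info m \<beta> p r c)"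
      by (rule sum_pairs_support[OF w(1)])
    also have "?S = insert ?e1 (insert ?e2 R)" using supp by (auto simp: R_def)
    also have "(\<Sum>p \<in> \<dots>. w p * edge_info m \<beta> p r c) = w ?e1 * edge_info m \<beta> ?e1 r c
        + (w ?e2 * edge_info m \<beta> ?e2 r c + (\<Sum>p \<in> R. w p * edge_info m \<beta> p r c))"
      using neq by (simp add: R_def finite_support)
    also have "(\<Sum>p \<in> R. w p * edge_info m \<beta> p r c) =
        (\<Sum>k < n. w (en k) * edge_info m \<beta> (en k) r c)"
      by (rule sum.reindex_bij_betw[OF en, symmetric])
    finally show ?thesis by (simp add: T_def d_def edge_info_def mult.assoc)
  qed
  have M: "information_mat m \<beta> (w(?e1 := s, ?e2 := u, ?e3 := w ?e3 + t)) =
      M (s * ?L1) (u * ?L2) (t * ?L3)" for s u t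
  proof -
    have "(\<Sum>p \<in> pairs m. (w(?e1 := s, ?e2 := u, ?e3 := w ?e3 + t)) p * edge_info m \<beta> p r c) =
        s * edge_info m \<beta> ?e1 r c + u * edge_info m \<beta> ?e2 r c + t * edge_info m \<beta> ?e3 r c
        + T r c"
      for r c
      unfolding sum_three_updates[OF finite_pairs pairs e3 neq, of w s u t "\<lambda>p. edge_info m \<beta> p r c"] base
      by (simp add: algebra_simps)
    then show ?thesis
      unfolding information_mat_edge_info M_def n diff by (simp only: edge_info_edge mult.assoc)
  qed
  have M0: "information_mat m \<beta> w = M (w ?e1 * ?L1) (w ?e2 * ?L2) 0"
    using M[of "w ?e1" "w ?e2" 0] by simp
  have "K > 0"
  proof -
    have "0 < w ?e1 * ?L1 * (w ?e2 * ?L2) * K" using det by (simp add: M0 K)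
    moreover have "0 < w ?e1 * ?L1 * (w ?e2 * ?L2)" by (simp add: pos intensity_pos)
    ultimately show ?thesis by (rule zero_less_mult_pos)
  qed
  obtain s t where st: "s > 0" "t > 0" "2 * s + t = w ?e1 + w ?e2"
    "(w ?e1 * ?L1) * (w ?e2 * ?L2) < (s * ?L1) * (s * ?L2) + (s * ?L1) * (t * ?L3) + (s * ?L2) * (t * ?L3)"
    using better_split[OF intensity_pos intensity_pos intensity_pos detour pos] by blast
  define w' where "w' = w(?e1 := s, ?e2 := s, ?e3 := w ?e3 + t)"
  have "design m w'"
    unfolding design_def
  proof
    show "\<forall>p \<in> pairs m. 0 \<le> w' p"
      using w(1) st e3 by (auto simp: w'_def design_def add_nonneg_nonneg)
    show "sum w' (pairs m) = 1"
      using sum_three_updates[OF finite_pairs pairs e3 neq, of w s s t "\<lambda>_. 1"] w(1) st(3)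
      by (simp add: w'_def design_def)
  qed
  moreover have "det (information_mat m \<beta> w') > det (information_mat m \<beta> w)"
    using st(4) \<open>K > 0\<close> by (simp add: w'_def M M0 K)
  ultimately show ?thesis by blast
qed

section \<open>The design graph\<close>

lemma design_graph_simps [simp]:
  "pverts (design_graph m w) = {1..m}"
  "parcs (design_graph m w) = support m w \<union> (support m w)\<inverse>"
  by (simp_all add: design_graph_def)

lemma pair_graph_design_graph: "pair_graph (design_graph m w)"
proof
  show "finite (parcs (design_graph m w))"
    using finite_support by simp
  show "symmetric (with_proj (design_graph m w))"
    by (auto simp: symmetric_def sym_def)
qed (auto simp: support_def pairs_def)

lemma arc_design_graph:
  "(u, v) \<in> parcs (design_graph m w) \<longleftrightarrow> edge u v \<in> support m w"
proof (cases "u < v")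
  case True
  then show ?thesis by (auto simp: edge_def support_def pairs_def)
next
  case False
  then show ?thesis by (auto simp: edge_def support_def pairs_def)
qed

lemma edge_commute: "edge u v = edge v u"
  by (simp add: edge_eq_iff)

lemma connected_design_graph:
  assumes "m \<ge> 2" "design m w" "det (information_mat m \<beta> w) \<noteq> 0"
  shows "Digraph_Component.connected (with_proj (design_graph m w))"
proof -
  let ?G = "design_graph m w"
  interpret pair_graph ?G by (rule pair_graph_design_graph)
  have sym: "mk_symmetric (with_proj ?G) = ?G"
    by (auto simp: mk_symmetric_def design_graph_def)
  have "u \<rightarrow>\<^sup>*\<^bsub>with_proj ?G\<^esub> v" if u: "u \<in> {1..m}" and v: "v \<in> {1..m}" for u v
  proof -
    define x :: "nat \<Rightarrow> real" where "x k = of_bool (u \<rightarrow>\<^sup>*\<^bsub>with_proj ?G\<^esub> k)" for k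
    have "x i = x j" if "(i, j) \<in> support m w" for i j
    proof -
      have "(i, j) \<in> parcs ?G" "(j, i) \<in> parcs ?G" using that by auto
      then have "u \<rightarrow>\<^sup>*\<^bsub>with_proj ?G\<^esub> i \<longleftrightarrow> u \<rightarrow>\<^sup>*\<^bsub>with_proj ?G\<^esub> j"
        using reachable_adj_trans[of u i j] reachable_adj_trans[of u j i] by blast
      then show ?thesis
        by (simp add: x_def)
    qed
    then have "x u = x m" "x v = x m"
      using edge_constant_potential[OF assms(2,3)] u v by blast+
    moreover have "x u = 1" using u by (simp add: x_def)
    ultimately show ?thesis by (simp add: x_def split: if_splits)
  qed
  then show ?thesis
    using assms(1) unfolding Digraph_Component.connected_def sym
    by (intro strongly_connectedI) auto
qed

lemma pcas_constant:
  assumes "pcas u p v" "\<And>i j. (i, j) \<in> set p \<Longrightarrow> x i = x j"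
  shows "x u = x v"
  using assms
proof (induction p arbitrary: u)
  case (Cons e p)
  have "x u = x (snd e)" using Cons.prems by (cases e) auto
  also have "\<dots> = x v" using Cons by auto
  finally show ?case .
qed simp

text \<open>
  A potential that separates only the endpoints of the first edge of a cycle is constant along the
  rest of the cycle, which connects the same endpoints. The length bound ensures that the rest does
  not run through the first edge backwards.
\<close>

lemma acyclic_design_graph:
  assumes "design m w" "saturated m w" "det (information_mat m \<beta> w) \<noteq> 0"
  shows "\<not> (\<exists>p. pre_digraph.cycle (with_proj (design_graph m w)) p \<and> length p \<ge> 3)"
proof
  let ?G = "design_graph m w"
  interpret pair_graph ?G by (rule pair_graph_design_graph)
  assume "\<exists>p. pre_digraph.cycle (with_proj ?G) p \<and> length p \<ge> 3"
  then obtain p u where p: "awalk u p u" "distinct (tl (pawalk_verts u p))" "length p \<ge> 3"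
    by (auto simp: cycle_def)
  then obtain e q where pq: "p = e # q" by (cases p) auto
  obtain v where e: "e = (u, v)" using p(1) pq by (cases e) (auto simp: awalk_def)
  have q: "pcas v q u" "set q \<subseteq> parcs ?G" "(u, v) \<in> parcs ?G" "distinct (pawalk_verts v q)"
    "length q \<ge> 2"
    using p pq e by (auto simp: awalk_def)
  have verts: "pawalk_verts v q = v # map snd q" "pawalk_verts v q = map fst q @ [u]"
    using q(1) by (induction q arbitrary: v) auto
  have away: "(u, v) \<notin> set q" "(v, u) \<notin> set q"
  proof -
    show "(u, v) \<notin> set q"
      using verts(1) q(4) by force
    show "(v, u) \<notin> set q"
    proof
      assume "(v, u) \<in> set q"
      then obtain q1 q2 where s: "q = q1 @ (v, u) # q2" by (auto simp: in_set_conv_decomp)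
      \<comment> \<open>\<open>v\<close> is the first and \<open>u\<close> the last vertex of \<open>q\<close>, and no vertex repeats.\<close>
      have "q1 = []" using q(4) verts s by (cases q1) auto
      moreover have "q2 = []" using q(4) verts s by (cases q2 rule: rev_cases) auto
      ultimately show False using s q(5) by simp
    qed
  qed
  have "edge u v \<in> support m w" using q(3) unfolding arc_design_graph .
  then obtain x :: "nat \<Rightarrow> real" where x: "x (min u v) \<noteq> x (max u v)"
    "\<And>i j. (i, j) \<in> support m w - {edge u v} \<Longrightarrow> x i = x j"
    using edge_separating_potential[OF assms, of "min u v" "max u v"] by (auto simp: edge_def)
  have "x v = x u"
    using q(1)
  proof (rule pcas_constant)
    fix i j assume ij: "(i, j) \<in> set q"
    have "edge i j \<in> support m w" using ij q(2) unfolding arc_design_graph[symmetric] by blast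
    moreover have "edge i j \<noteq> edge u v"
      using ij away by (auto simp: edge_eq_iff)
    ultimately have "x (min i j) = x (max i j)" using x(2) by (auto simp: edge_def)
    then show "x i = x j" by (auto simp: min_def max_def split: if_splits)
  qed
  then show False using x(1) by (auto simp: min_def max_def split: if_splits)
qed

lemma same_sign_pair:
  fixes f :: "'a \<Rightarrow> real"
  assumes "2 < card N"
  shows "\<exists>a \<in> N. \<exists>b \<in> N. a \<noteq> b \<and> 0 \<le> f a * f b"
proof -
  obtain T where "T \<subseteq> N" "card T = 3"
    using obtain_subset_with_card_n[of 3 N] assms by auto
  then obtain a b c where abc: "{a, b, c} \<subseteq> N" "a \<noteq> b" "a \<noteq> c" "b \<noteq> c"
    by (auto simp: card_3_iff)
  have "0 \<le> f a * f b \<or> 0 \<le> f a * f c \<or> 0 \<le> f b * f c"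
    unfolding zero_le_mult_iff by linarith
  then show ?thesis using abc by blast
qed

theorem theorem9:
  fixes m :: nat and \<beta> :: "real vec" and w :: "nat \<times> nat \<Rightarrow> real"
  assumes "m \<ge> 2"
    and "\<beta> \<in> carrier_vec (m - 1)"
    and "design m w"
    and "saturated m w"
    and "locally_D_optimal m \<beta> w"
  shows "path_graph (design_graph m w) \<and> pverts (design_graph m w) = {1..m}"
proof -
  let ?G = "design_graph m w"
  have det: "det (information_mat m \<beta> w) > 0"
    using assms(1,5) by (rule locally_D_optimal_det_pos)
  have "undirected_tree ?G"
    unfolding undirected_tree_def
    using pair_graph_design_graph connected_design_graph[OF assms(1,3)]
      acyclic_design_graph[OF assms(3,4)] det by (metis less_irrefl)
  moreover have "card {v \<in> pverts ?G. (u, v) \<in> parcs ?G} \<le> 2" for u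
  proof (rule ccontr)
    assume "\<not> ?thesis"
    then obtain a b where ab: "(u, a) \<in> parcs ?G" "(u, b) \<in> parcs ?G" "a \<noteq> b"
      "0 \<le> (param m \<beta> a - param m \<beta> u) * (param m \<beta> b - param m \<beta> u)"
      using same_sign_pair[of "{v \<in> pverts ?G. (u, v) \<in> parcs ?G}" "\<lambda>v. param m \<beta> v - param m \<beta> u"]
      by auto
    have "edge a u \<in> support m w" "edge b u \<in> support m w"
      using ab(1,2) unfolding arc_design_graph by (simp_all add: edge_commute)
    then obtain w' where "design m w'" "det (information_mat m \<beta> w') > det (information_mat m \<beta> w)"
      using rerouting_improves[OF assms(3,4) det _ _ ab(3) intensity_detour[OF ab(4)]] by blast
    then show False
      using locally_D_optimal_det_le[OF assms(1,5)] by fastforce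
  qed
  ultimately show ?thesis
    by (simp add: path_graph_def)
qed

end
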